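(* For each integer $g\ge 1$ let $\gamma^\sigma_g = |\mathcal G^\sigma(g)|/2^{\lfloor (g-1)/2\rfloor}$, where $\mathcal G^\sigma(g)$ is the set of those $S\in\mathcal S^\sigma(g)$ with $A(S)=\{0\}\cup(g,\infty)$. Then the sequence $(\gamma^\sigma_g)_{g\ge1}$ is (weakly) decreasing and converges to a real number $\gamma^\sigma_\infty$ satisfying $|\gamma^\sigma_\infty - 0.230653|\le 0.00579$.
   Context: All intervals are intervals of integers. A numerical set is a cofinite subset $S\subseteq\mathbb N=\{0,1,2,\dots\}$ containing $0$; for $S\ne\mathbb N$ its Frobenius number is $\max(\mathbb N-S)$. The atom monoid of $S$ is $A(S)=\{n\in\mathbb Z : n+S\subseteq S\}$. A numerical set $S$ with Frobenius number $g$ is symmetric if for every integer $x$: $x\in S\iff g-x\notin S$ (only possible for $g$ odd). If $g$ is even, $S$ is pseudosymmetric if $g/2\notin S$ and for every integer $x\neq g/2$: $x\in S\iff g-x\notin S$. For $g\ge1$, $\mathcal S^\sigma(g)$ is the set of symmetric numerical sets with Frobenius number $g$ when $g$ is odd, and the set of pseudosymmetric numerical sets with Frobenius number $g$ when $g$ is even; it has $2^{\lfloor (g-1)/2\rfloor}$ elements. *)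

theory Defs
  imports Complex_Main
begin

definition numerical_set :: "nat set \<Rightarrow> bool" where
  "numerical_set S \<longleftrightarrow> 0 \<in> S \<and> finite (UNIV - S)"

text \<open>Only meaningful for a numerical set different from \<open>UNIV\<close>.\<close>

definition frobenius_number :: "nat set \<Rightarrow> nat" where
  "frobenius_number S = Max (UNIV - S)"

definition numerical_sets_with_frobenius :: "nat \<Rightarrow> nat set set" where
  "numerical_sets_with_frobenius g =
     {S. numerical_set S \<and> S \<noteq> UNIV \<and> frobenius_number S = g}"

text \<open>Integers range over the whole of \<open>int\<close> below, as the shifts \<open>n + S\<close> and the
  reflection \<open>x \<mapsto> g - x\<close> may leave the natural numbers; \<open>S\<close> is embedded as \<open>int ` S\<close>.\<close>

definition atom_monoid :: "nat set \<Rightarrow> int set" where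
  "atom_monoid S = {n. (\<lambda>s. n + s) ` (int ` S) \<subseteq> int ` S}"

definition symmetric_set :: "nat \<Rightarrow> nat set \<Rightarrow> bool" where
  "symmetric_set g S \<longleftrightarrow> S \<in> numerical_sets_with_frobenius g \<and>
     (\<forall>x::int. x \<in> int ` S \<longleftrightarrow> int g - x \<notin> int ` S)"

definition pseudosymmetric_set :: "nat \<Rightarrow> nat set \<Rightarrow> bool" where
  "pseudosymmetric_set g S \<longleftrightarrow> even g \<and> S \<in> numerical_sets_with_frobenius g \<and>
     g div 2 \<notin> S \<and>
     (\<forall>x::int. x \<noteq> int (g div 2) \<longrightarrow> (x \<in> int ` S \<longleftrightarrow> int g - x \<notin> int ` S))"

definition S_sigma :: "nat \<Rightarrow> nat set set" where
  "S_sigma g = (if odd g then {S. symmetric_set g S} else {S. pseudosymmetric_set g S})"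

definition G_sigma :: "nat \<Rightarrow> nat set set" where
  "G_sigma g = {S \<in> S_sigma g. atom_monoid S = {0} \<union> {int g<..}}"

definition gamma_sigma :: "nat \<Rightarrow> real" where
  "gamma_sigma g = real (card (G_sigma g)) / 2 ^ ((g - 1) div 2)"

end

theory Submission
  imports Defs
begin

text \<open>Put \<open>h = (g - 1) div 2\<close>. A set \<open>S \<in> S_sigma g\<close> is determined by its trace \<open>B\<close> on \<open>{0..h}\<close>,
  which may be any subset containing \<open>0\<close>, and by symmetry \<open>g - m\<close> with \<open>m \<le> h\<close> is an atom iff
  \<open>m \<notin> B + B\<close>. An atom \<open>n \<le> h\<close> produces the atom \<open>g - g mod n\<close>, a multiple of \<open>n\<close>, so nothing
  else has to be tested: \<open>gamma_sigma g\<close> is the proportion of those \<open>B\<close> with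
  \<open>{0..h} \<subseteq> B + B\<close>. It depends on \<open>h\<close> only, and it decreases because restricting such a set to a shorter
  interval preserves the property.

  For the numerical bounds, fix the trace \<open>C\<close> on \<open>{0..k}\<close> and let the larger elements be random.
  For \<open>m \<in> {k+1..2k+1} - (C + C)\<close> the failure \<open>m \<notin> S + S\<close> means that \<open>S\<close> avoids the part of
  \<open>m - C\<close> above \<open>k\<close>, so joint probabilities of failures are powers of \<open>1/2\<close>. Bonferroni's inequality
  of second order, summed over all \<open>C\<close> for \<open>k = 17\<close>, bounds the limit from above; the union bound for
  \<open>k = 13\<close>, with a geometric series for the failures \<open>m \<ge> 2k+2\<close>, bounds it from below.\<close>

section \<open>Reduction to additive bases\<close>

text \<open>Membership of m in the sumset S + S; the guard \<open>i \<le> m\<close> excludes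
  truncated values of \<open>m - i\<close>.\<close>

definition rep :: "nat set \<Rightarrow> nat \<Rightarrow> bool" where
  "rep S m \<longleftrightarrow> (\<exists>i\<in>S. i \<le> m \<and> m - i \<in> S)"

definition bases :: "nat \<Rightarrow> nat set set" where
  "bases n = {S. S \<subseteq> {..n} \<and> 0 \<in> S \<and> (\<forall>m\<le>n. rep S m)}"

lemma finite_bases: "finite (bases n)"
  by (rule finite_subset[of _ "Pow {..n}"]) (auto simp: bases_def)

lemma rep_mono: "rep S m \<Longrightarrow> S \<subseteq> T \<Longrightarrow> rep T m"
  unfolding rep_def by blast

lemma rep_cong: "S \<inter> {..n} = T \<inter> {..n} \<Longrightarrow> m \<le> n \<Longrightarrow> rep S m = rep T m"
  unfolding rep_def set_eq_iff by (metis Int_iff atMost_iff diff_le_self le_trans)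

section \<open>Symmetric and pseudosymmetric sets determined by their lower half\<close>

lemma numerical_sets_with_frobenius_iff:
  "S \<in> numerical_sets_with_frobenius g \<longleftrightarrow> 0 \<in> S \<and> g \<notin> S \<and> (\<forall>x>g. x \<in> S)"
proof
  assume S: "S \<in> numerical_sets_with_frobenius g"
  then have fin: "finite (UNIV - S)" and ne: "UNIV - S \<noteq> {}" and g: "Max (UNIV - S) = g"
    by (auto simp: numerical_sets_with_frobenius_def numerical_set_def frobenius_number_def)
  have "g \<notin> S" using Max_in[OF fin ne] g by auto
  moreover have "x \<in> S" if "x > g" for x
    using Max_ge[OF fin, of x] g that by force
  ultimately show "0 \<in> S \<and> g \<notin> S \<and> (\<forall>x>g. x \<in> S)"
    using S by (auto simp: numerical_sets_with_frobenius_def numerical_set_def)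
next
  assume S: "0 \<in> S \<and> g \<notin> S \<and> (\<forall>x>g. x \<in> S)"
  then have sub: "UNIV - S \<subseteq> {..g}" using linorder_not_less by auto
  then have fin: "finite (UNIV - S)" by (rule finite_subset) simp
  moreover have "Max (UNIV - S) = g"
    by (rule Max_eqI[OF fin]) (use S sub in auto)
  ultimately show "S \<in> numerical_sets_with_frobenius g"
    using S by (auto simp: numerical_sets_with_frobenius_def numerical_set_def frobenius_number_def)
qed

text \<open>For x < 0 or x > g one of x and g - x is negative, hence outside S, and the other
  exceeds g, hence inside. So the condition has content only on {0..g}. The exception z is the
  midpoint of the pseudosymmetric case.\<close>

lemma int_reflect_iff:
  fixes S :: "nat set" and g z :: nat
  assumes "\<forall>x>g. x \<in> S"
  shows "(\<forall>x::int. x \<noteq> int z \<longrightarrow> x \<in> int ` S \<longleftrightarrow> int g - x \<notin> int ` S) \<longleftrightarrow>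
         (\<forall>x\<le>g. x \<noteq> z \<longrightarrow> x \<in> S \<longleftrightarrow> g - x \<notin> S)" (is "?L = ?R")
    and "(\<forall>x::int. x \<in> int ` S \<longleftrightarrow> int g - x \<notin> int ` S) \<longleftrightarrow>
         (\<forall>x\<le>g. x \<in> S \<longleftrightarrow> g - x \<notin> S)" (is "?L' = ?R'")
proof -
  have img: "int y \<in> int ` S \<longleftrightarrow> y \<in> S" for y by auto
  have *: "x \<in> int ` S \<longleftrightarrow> int g - x \<notin> int ` S"
    if "0 \<le> x \<Longrightarrow> nat x \<le> g \<Longrightarrow> nat x \<in> S \<longleftrightarrow> g - nat x \<notin> S" for x :: int
  proof -
    consider "x < 0" | "x > int g" | "0 \<le> x" "x \<le> int g" by linarith
    then show ?thesis
    proof cases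
      case 1
      then have "int g - x = int (nat (int g - x))" "nat (int g - x) > g" by auto
      then show ?thesis using 1 assms img by (metis imageE not_less of_nat_0_le_iff)
    next
      case 2
      then have "x = int (nat x)" "nat x > g" "int g - x < 0" by auto
      then show ?thesis using assms img by (metis imageE not_less of_nat_0_le_iff)
    next
      case 3
      then have "x = int (nat x)" "nat x \<le> g" "int g - x = int (g - nat x)" by auto
      then show ?thesis using that 3 img by metis
    qed
  qed
  have **: "x \<in> S \<longleftrightarrow> g - x \<notin> S" if "x \<le> g" "int x \<in> int ` S \<longleftrightarrow> int g - int x \<notin> int ` S" for x
    using that img by (metis of_nat_diff)
  show "?L = ?R"
  proof
    show "?L \<Longrightarrow> ?R" using ** by (metis of_nat_eq_iff)
    assume R: ?R
    show ?L
    proof (intro allI impI, rule *)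
      fix x :: int
      assume x: "x \<noteq> int z" "0 \<le> x" "nat x \<le> g"
      then have "nat x \<noteq> z" by linarith
      then show "nat x \<in> S \<longleftrightarrow> g - nat x \<notin> S" using R x by blast
    qed
  qed
  show "?L' = ?R'" using * ** by blast
qed

text \<open>Reflection makes the part of S in {h+1..g} the mirrored complement of its trace on
  {0..h}. The guard \<open>g - x \<le> h\<close> fails only at the midpoint x = h + 1 of an even g,
  which has to be left out; thus both parities share one description.\<close>

lemma S_sigma_iff:
  assumes "g \<ge> 1" and h: "h = (g - 1) div 2"
  shows "S \<in> S_sigma g \<longleftrightarrow> 0 \<in> S \<and> (\<forall>x>g. x \<in> S) \<and>
           (\<forall>x. h < x \<and> x \<le> g \<longrightarrow> (x \<in> S \<longleftrightarrow> g - x \<le> h \<and> g - x \<notin> S))" (is "_ = ?R")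
proof (cases "odd g")
  case True
  then have g: "g = 2 * h + 1" using assms by presburger
  have "S \<in> S_sigma g \<longleftrightarrow> symmetric_set g S"
    using True by (simp add: S_sigma_def)
  also have "\<dots> \<longleftrightarrow> (0 \<in> S \<and> g \<notin> S \<and> (\<forall>x>g. x \<in> S)) \<and> (\<forall>x\<le>g. x \<in> S \<longleftrightarrow> g - x \<notin> S)" (is "_ = ?L")
    unfolding symmetric_set_def numerical_sets_with_frobenius_iff
    using int_reflect_iff(2)[of g S] by blast
  also have "\<dots> = ?R"
  proof
    assume L: ?L
    have "x \<in> S \<longleftrightarrow> g - x \<le> h \<and> g - x \<notin> S" if "h < x" "x \<le> g" for x
    proof -
      have "g - x \<le> h" using that g by simp
      then show ?thesis using L that by blast
    qed
    then show ?R using L by blast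
  next
    assume R: ?R
    have "x \<in> S \<longleftrightarrow> g - x \<notin> S" if "x \<le> g" for x
    proof (cases "h < x")
      case True
      then have "g - x \<le> h" using that g by simp
      then show ?thesis using R that True by blast
    next
      case False
      then have "h < g - x" "g - x \<le> g" "g - (g - x) = x" using g by auto
      then show ?thesis using R False by (metis not_less)
    qed
    moreover have "g \<notin> S"
    proof -
      have "h < g" "g \<le> g" "g - g = 0" using g by auto
      then show ?thesis using R by metis
    qed
    ultimately show ?L using R by blast
  qed
  finally show ?thesis .
next
  case False
  then have g: "g = 2 * (h + 1)" using assms by presburger
  then have g2: "g div 2 = h + 1" by simp
  have "S \<in> S_sigma g \<longleftrightarrow> pseudosymmetric_set g S"
    using False by (simp add: S_sigma_def)
  also have "\<dots> \<longleftrightarrow> (0 \<in> S \<and> g \<notin> S \<and> (\<forall>x>g. x \<in> S)) \<and> h + 1 \<notin> S \<and>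
          (\<forall>x\<le>g. x \<noteq> h + 1 \<longrightarrow> (x \<in> S \<longleftrightarrow> g - x \<notin> S))" (is "_ = ?L")
    unfolding pseudosymmetric_set_def numerical_sets_with_frobenius_iff g2
    using int_reflect_iff(1)[of g S "h + 1"] False by blast
  also have "\<dots> = ?R"
  proof
    assume L: ?L
    have "x \<in> S \<longleftrightarrow> g - x \<le> h \<and> g - x \<notin> S" if "h < x" "x \<le> g" for x
    proof (cases "x = h + 1")
      case True
      then have "\<not> g - x \<le> h" using g by simp
      then show ?thesis using L True by blast
    next
      case False
      then have "g - x \<le> h" using that g by simp
      then show ?thesis using L that False by blast
    qed
    then show ?R using L by blast
  next
    assume R: ?R
    have "x \<in> S \<longleftrightarrow> g - x \<notin> S" if "x \<le> g" "x \<noteq> h + 1" for x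
    proof (cases "h < x")
      case True
      then have "g - x \<le> h" using that g by simp
      then show ?thesis using R that True by blast
    next
      case False
      then have "h < g - x" "g - x \<le> g" "g - (g - x) = x" using g by auto
      then show ?thesis using R False by (metis not_less)
    qed
    moreover have "g \<notin> S"
    proof -
      have "h < g" "g \<le> g" "g - g = 0" using g by auto
      then show ?thesis using R by metis
    qed
    moreover have "h + 1 \<notin> S"
    proof -
      have "h < h + 1" "h + 1 \<le> g" "\<not> g - (h + 1) \<le> h" using g by auto
      then show ?thesis using R by blast
    qed
    ultimately show ?L using R by blast
  qed
  finally show ?thesis .
qed

lemma atom_monoid_S_sigma_iff:
  assumes g: "g \<ge> 1" and h: "h = (g - 1) div 2" and S: "S \<in> S_sigma g"
  shows "atom_monoid S = {0} \<union> {int g<..} \<longleftrightarrow> (\<forall>m\<le>h. rep S m)"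
proof -
  define atom where "atom n \<longleftrightarrow> (\<forall>s\<in>S. n + s \<in> S)" for n
  have S0: "0 \<in> S" and Sg: "\<And>x. x > g \<Longrightarrow> x \<in> S"
    and Sm: "\<And>x. h < x \<Longrightarrow> x \<le> g \<Longrightarrow> x \<in> S \<longleftrightarrow> g - x \<le> h \<and> g - x \<notin> S"
    using S S_sigma_iff[OF g h, of S] by auto
  have gh: "2 * h < g" using g h by auto
  have gS: "g \<notin> S" using Sm[of g] gh S0 by auto
  have mem: "int n \<in> atom_monoid S \<longleftrightarrow> atom n" for n
  proof -
    have "int n + int s \<in> int ` S \<longleftrightarrow> n + s \<in> S" for s
      by (metis image_iff of_nat_add of_nat_eq_iff)
    then show ?thesis by (simp add: atom_monoid_def atom_def image_subset_iff)
  qed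
  have neg: "n \<ge> 0" if "n \<in> atom_monoid S" for n
  proof -
    have "n + int 0 \<in> int ` S" using that S0 by (auto simp: atom_monoid_def)
    then show ?thesis by auto
  qed
  have big: "atom n" if "n > g" for n
    using that Sg by (auto simp: atom_def)
  have eq: "atom_monoid S = {0} \<union> {int g<..} \<longleftrightarrow> (\<forall>n. 0 < n \<and> n \<le> g \<longrightarrow> \<not> atom n)"
  proof
    assume A: "atom_monoid S = {0} \<union> {int g<..}"
    show "\<forall>n. 0 < n \<and> n \<le> g \<longrightarrow> \<not> atom n"
      using mem A by (metis Un_iff greaterThan_iff not_less of_nat_0_less_iff of_nat_le_iff
          order_less_irrefl singletonD)
  next
    assume A: "\<forall>n. 0 < n \<and> n \<le> g \<longrightarrow> \<not> atom n"
    show "atom_monoid S = {0} \<union> {int g<..}"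
    proof (intro set_eqI)
      fix x :: int
      show "x \<in> atom_monoid S \<longleftrightarrow> x \<in> {0} \<union> {int g<..}"
      proof (cases "x < 0")
        case True then show ?thesis using neg[of x] by auto
      next
        case False
        then obtain n where x: "x = int n" by (metis nonneg_int_cases not_less)
        have "atom n \<longleftrightarrow> n = 0 \<or> n > g"
          using A big by (cases "n = 0") (auto simp: atom_def leI)
        then show ?thesis using mem x by auto
      qed
    qed
  qed
  \<comment> \<open>For s \<le> m the point g - m + s lies above h and reflects to m - s, so it is
    in S iff m - s is not; for s > m it exceeds g.\<close>
  have refl: "atom (g - m) \<longleftrightarrow> \<not> rep S m" if m: "m \<le> h" for m
  proof
    assume a: "atom (g - m)"
    show "\<not> rep S m"
    proof
      assume "rep S m"
      then obtain i where i: "i \<in> S" "i \<le> m" "m - i \<in> S" by (auto simp: rep_def)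
      have "(g - m) + i \<in> S" using a i by (auto simp: atom_def)
      moreover have "g - ((g - m) + i) = m - i" "h < (g - m) + i" "(g - m) + i \<le> g"
        using i m gh by auto
      ultimately show False using Sm i(3) by metis
    qed
  next
    assume r: "\<not> rep S m"
    show "atom (g - m)"
      unfolding atom_def
    proof
      fix s assume s: "s \<in> S"
      show "g - m + s \<in> S"
      proof (cases "s \<le> m")
        case True
        then have "m - s \<notin> S" using r s by (auto simp: rep_def)
        moreover have "g - ((g - m) + s) = m - s" "h < (g - m) + s" "(g - m) + s \<le> g"
          using True m gh by auto
        moreover have "m - s \<le> h" using m by auto
        ultimately show ?thesis using Sm by metis
      next
        case False then show ?thesis using m gh by (intro Sg) auto
      qed
    qed
  qed
  \<comment> \<open>An atom n > h lies in S because 0 does, so it differs from g and is itself g - m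
    with m = g - n. For n \<le> h the largest multiple of n up to g serves; it is not g, as g would
    then be an atom and lie in S.\<close>
  have red: "\<exists>m. 0 < m \<and> m \<le> h \<and> atom (g - m)" if n: "0 < n" "n \<le> g" "atom n" for n
  proof (cases "h < n")
    case True
    have nS: "n \<in> S" using n S0 by (auto simp: atom_def)
    then have "n \<noteq> g" using gS by auto
    then have "0 < g - n" "g - n \<le> h" "g - (g - n) = n" using n True nS Sm[of n] by auto
    then show ?thesis using n by (metis)
  next
    case False
    have mult: "atom (q * n)" for q
      by (induction q) (use n(3) in \<open>auto simp: atom_def add.assoc\<close>)
    have q: "g div n * n = g - g mod n" by (simp add: minus_mod_eq_div_mult)
    have "g mod n \<noteq> 0"
    proof
      assume "g mod n = 0"
      then have "atom g" using mult[of "g div n"] q by simp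
      then show False using S0 gS by (auto simp: atom_def)
    qed
    moreover have "g mod n \<le> h" using False n(1) by (meson le_trans less_imp_le mod_less_divisor not_less)
    ultimately show ?thesis using mult[of "g div n"] q by (intro exI[of _ "g mod n"]) auto
  qed
  have "rep S 0" using S0 by (auto simp: rep_def)
  then have "(\<forall>n. 0 < n \<and> n \<le> g \<longrightarrow> \<not> atom n) \<longleftrightarrow> (\<forall>m\<le>h. rep S m)"
  proof -
    have "rep S m" if A: "\<forall>n. 0 < n \<and> n \<le> g \<longrightarrow> \<not> atom n" and "m \<le> h" for m
    proof -
      have "0 < g - m" "g - m \<le> g" using that gh by auto
      then show ?thesis using A refl[OF \<open>m \<le> h\<close>] by blast
    qed
    moreover have "\<not> atom n" if "\<forall>m\<le>h. rep S m" "0 < n" "n \<le> g" for n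
    proof
      assume "atom n"
      then show False using red[of n] refl that by blast
    qed
    ultimately show ?thesis by blast
  qed
  then show ?thesis using eq by simp
qed

lemma card_G_sigma:
  assumes g: "g \<ge> 1" and h: "h = (g - 1) div 2"
  shows "card (G_sigma g) = card (bases h)"
proof (rule bij_betw_same_card[of "\<lambda>S. S \<inter> {..h}"], rule bij_betw_imageI)
  have gh: "2 * h < g" using g h by auto
  have G: "S \<in> G_sigma g \<longleftrightarrow> S \<in> S_sigma g \<and> (\<forall>m\<le>h. rep S m)" for S
    using atom_monoid_S_sigma_iff[OF g h] by (auto simp: G_sigma_def)
  show "inj_on (\<lambda>S. S \<inter> {..h}) (G_sigma g)"
  proof (rule inj_onI, rule set_eqI)
    fix S T x assume ST: "S \<in> G_sigma g" "T \<in> G_sigma g" and eq: "S \<inter> {..h} = T \<inter> {..h}"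
    have low: "y \<in> S \<longleftrightarrow> y \<in> T" if "y \<le> h" for y using eq that by (metis Int_iff atMost_iff)
    consider "x \<le> h" | "x > g" | "h < x" "x \<le> g" by linarith
    then show "x \<in> S \<longleftrightarrow> x \<in> T"
      using ST low[of x] low[of "g - x"] unfolding G S_sigma_iff[OF g h] by cases blast+
  qed
  show "(\<lambda>S. S \<inter> {..h}) ` G_sigma g = bases h"
  proof (intro equalityI subsetI)
    fix B assume "B \<in> (\<lambda>S. S \<inter> {..h}) ` G_sigma g"
    then obtain S where S: "S \<in> G_sigma g" "B = S \<inter> {..h}" by blast
    then have "rep B m" if "m \<le> h" for m
      using that rep_cong[of B h S m] unfolding G by auto
    then show "B \<in> bases h" using S unfolding G S_sigma_iff[OF g h] by (auto simp: bases_def)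
  next
    fix B assume B: "B \<in> bases h"
    \<comment> \<open>The inverse of restriction: the upper half is filled by reflecting B, without
      the midpoint, and everything beyond g is added.\<close>
    define S where "S = B \<union> {g<..} \<union> {x. h < x \<and> x \<le> g \<and> g - x \<le> h \<and> g - x \<notin> B}"
    have SB: "S \<inter> {..h} = B" using B gh by (auto simp: S_def bases_def)
    have low: "y \<in> S \<longleftrightarrow> y \<in> B" if "y \<le> h" for y using SB that by (metis Int_iff atMost_iff)
    have "x \<in> S \<longleftrightarrow> g - x \<le> h \<and> g - x \<notin> S" if "h < x" "x \<le> g" for x
    proof -
      have "x \<notin> B" using B that by (auto simp: bases_def)
      then show ?thesis using that low[of "g - x"] by (auto simp: S_def)
    qed
    then have "S \<in> S_sigma g" using B unfolding S_sigma_iff[OF g h] by (auto simp: S_def bases_def)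
    moreover have "rep S m" if "m \<le> h" for m
      using that B SB rep_cong[of S h B m] by (auto simp: bases_def)
    ultimately have "S \<in> G_sigma g" unfolding G by blast
    then show "B \<in> (\<lambda>S. S \<inter> {..h}) ` G_sigma g" using SB by blast
  qed
qed

section \<open>Enumeration by prefixes\<close>

definition fibre :: "nat \<Rightarrow> nat \<Rightarrow> nat set \<Rightarrow> nat set set" where
  "fibre n k B = {S \<in> bases n. S \<inter> {..k} = B}"

lemma bases_restrict:
  assumes "S \<in> bases n" "k \<le> n"
  shows "S \<inter> {..k} \<in> bases k"
proof -
  have "rep (S \<inter> {..k}) m" if "m \<le> k" for m
    using assms that rep_cong[of "S \<inter> {..k}" k S m] by (auto simp: bases_def)
  then show ?thesis using assms by (auto simp: bases_def)
qed

lemma card_bases_fibre: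
  assumes "k \<le> n"
  shows "card (bases n) = (\<Sum>B\<in>bases k. card (fibre n k B))"
proof -
  have "(\<Sum>B\<in>bases k. \<Sum>S\<in>{S \<in> bases n. S \<inter> {..k} = B}. 1) = (\<Sum>S\<in>bases n. (1::nat))"
    using bases_restrict assms by (intro sum.group) (auto simp: finite_bases)
  then show ?thesis by (simp add: fibre_def)
qed

lemma fibre_self: "B \<in> bases k \<Longrightarrow> fibre k k B = {B}"
  by (auto simp: fibre_def bases_def)

lemma insert_bases:
  assumes "B \<in> bases k"
  shows "insert (Suc k) B \<in> bases (Suc k)"
proof -
  have "rep (insert (Suc k) B) m" if "m \<le> Suc k" for m
  proof (cases "m = Suc k")
    case True
    then show ?thesis using assms by (auto simp: rep_def bases_def intro!: bexI[of _ 0])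
  next
    case False
    then show ?thesis using assms that rep_mono[of B m] by (auto simp: bases_def le_Suc_eq)
  qed
  then show ?thesis using assms by (auto simp: bases_def)
qed

text \<open>The branching rule of the enumeration: the child with k + 1 is always a basis, since k +
  1 = 0 + (k + 1); the child without it survives only if k + 1 is already a sum, because later
  elements are too large to help.\<close>

lemma fibre_Suc:
  assumes "B \<in> bases k" "k < n"
  shows "fibre n k B = fibre n (Suc k) (insert (Suc k) B) \<union> fibre n (Suc k) B"
    and "fibre n (Suc k) (insert (Suc k) B) \<inter> fibre n (Suc k) B = {}"
    and "\<not> rep B (Suc k) \<Longrightarrow> fibre n (Suc k) B = {}"
    and "rep B (Suc k) \<Longrightarrow> B \<in> bases (Suc k)"
proof -
  have B: "Suc k \<notin> B" "B \<inter> {..k} = B" using assms by (auto simp: bases_def)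
  have "S \<inter> {..k} = B \<longleftrightarrow> S \<inter> {..Suc k} = insert (Suc k) B \<or> S \<inter> {..Suc k} = B" for S
  proof
    assume "S \<inter> {..k} = B"
    then show "S \<inter> {..Suc k} = insert (Suc k) B \<or> S \<inter> {..Suc k} = B"
      by (auto simp: atMost_Suc)
  next
    assume "S \<inter> {..Suc k} = insert (Suc k) B \<or> S \<inter> {..Suc k} = B"
    moreover have "S \<inter> {..k} = S \<inter> {..Suc k} \<inter> {..k}" by auto
    ultimately show "S \<inter> {..k} = B" using B by auto
  qed
  then show "fibre n k B = fibre n (Suc k) (insert (Suc k) B) \<union> fibre n (Suc k) B"
    by (auto simp: fibre_def)
  show "fibre n (Suc k) (insert (Suc k) B) \<inter> fibre n (Suc k) B = {}"
    using B by (auto simp: fibre_def)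
  show "fibre n (Suc k) B = {}" if "\<not> rep B (Suc k)"
    using assms that bases_restrict[of _ n "Suc k"] by (auto simp: fibre_def bases_def)
  show "B \<in> bases (Suc k)" if "rep B (Suc k)"
    using assms that by (auto simp: bases_def le_Suc_eq)
qed

lemma finite_fibre: "finite (fibre n k B)"
  by (simp add: fibre_def finite_bases)

text \<open>The denominator counts the subsets of {0..n} that contain 0.\<close>

definition density :: "nat \<Rightarrow> real" where
  "density n = card (bases n) / 2 ^ n"

text \<open>A basis for {0..k} has at most two extensions to {0..k+1}, while the denominator
  doubles.\<close>

lemma decseq_density: "decseq density"
proof (rule decseq_SucI)
  fix k
  have "card (bases (Suc k)) \<le> (\<Sum>B\<in>bases k. 2)"
    unfolding card_bases_fibre[OF le_SucI[OF le_refl], of k]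
  proof (rule sum_mono)
    fix B assume "B \<in> bases k"
    have "fibre (Suc k) k B \<subseteq> {insert (Suc k) B, B}"
      by (auto simp: fibre_def bases_def atMost_Suc)
    then have "card (fibre (Suc k) k B) \<le> card {insert (Suc k) B, B}" by (intro card_mono) auto
    also have "\<dots> \<le> 2" by (simp add: card_insert_le_m1)
    finally show "card (fibre (Suc k) k B) \<le> 2" .
  qed
  then have "real (card (bases (Suc k))) \<le> 2 * real (card (bases k))" by simp
  then show "density (Suc k) \<le> density k" by (simp add: density_def field_simps)
qed

text \<open>A set \<open>B \<subseteq> {..k}\<close> is encoded by the list of pairs \<open>(i \<in> B, k + 1 + i \<in> B + B)\<close> for \<open>i \<le> k\<close>,
  see \<open>state\<close> below. The function \<open>step c\<close> decides whether \<open>k + 1\<close> is added; its argument \<open>b\<close> is the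
  first bit of the pair in front of the list, as the second components move up by one place.\<close>

fun step :: "bool \<Rightarrow> bool \<Rightarrow> (bool \<times> bool) list \<Rightarrow> (bool \<times> bool) list" where
  "step c b [] = [(b, c), (c, False)]"
| "step c b ((b', r') # x) = (b, r' \<or> (c \<and> b')) # step c b' x"

text \<open>Sums f over the descendants d levels down. The head flag r tells whether k + 1 is
  already a sum, that is, whether it may be left out.\<close>

fun tree :: "((bool \<times> bool) list \<Rightarrow> int) \<Rightarrow> nat \<Rightarrow> (bool \<times> bool) list \<Rightarrow> int" where
  "tree f 0 x = f x"
| "tree f (Suc d) [] = 0"
| "tree f (Suc d) ((b, r) # x) =
     tree f d (step True b x) + (if r then tree f d (step False b x) else 0)"

definition state :: "nat \<Rightarrow> nat set \<Rightarrow> (bool \<times> bool) list" where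
  "state k B = map (\<lambda>i. (i \<in> B, rep B (Suc k + i))) [0..<Suc k]"

lemma step_map:
  assumes "j \<le> k"
  shows "step c (\<beta> j) (map (\<lambda>i. (\<beta> i, \<rho> i)) [Suc j..<Suc k]) =
    map (\<lambda>i. (\<beta> i, \<rho> (Suc i) \<or> (c \<and> \<beta> (Suc i)))) [j..<k] @ [(\<beta> k, c), (c, False)]"
  using assms
proof (induction rule: inc_induct)
  case base
  show ?case by simp
next
  case (step j)
  have "[Suc j..<Suc k] = Suc j # [Suc (Suc j)..<Suc k]" "[j..<k] = j # [Suc j..<k]"
    using step by (simp_all add: upt_conv_Cons del: upt_Suc)
  then show ?case using step by (simp del: upt_Suc)
qed

lemma rep_bounded:
  assumes "rep B m" "B \<subseteq> {..k}"
  shows "m \<le> 2 * k"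
proof -
  obtain j where "j \<in> B" "m - j \<in> B" "j \<le> m" using assms(1) by (auto simp: rep_def)
  then have "j \<le> k" "m - j \<le> k" "j \<le> m" using assms(2) by auto
  then show ?thesis by linarith
qed

lemma rep_insert_Suc:
  assumes "B \<subseteq> {..k}" "i \<le> k"
  shows "rep (insert (Suc k) B) (Suc k + i) \<longleftrightarrow> rep B (Suc k + i) \<or> i \<in> B"
proof
  assume "rep (insert (Suc k) B) (Suc k + i)"
  then obtain j where "j \<in> insert (Suc k) B" "Suc k + i - j \<in> insert (Suc k) B" "j \<le> Suc k + i"
    unfolding rep_def by blast
  moreover have "Suc k + i - j \<noteq> Suc k \<or> j = i" by auto
  ultimately show "rep B (Suc k + i) \<or> i \<in> B" using assms unfolding rep_def by auto
next
  assume "rep B (Suc k + i) \<or> i \<in> B"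
  then show "rep (insert (Suc k) B) (Suc k + i)"
    using rep_mono[of B "Suc k + i" "insert (Suc k) B"] by (auto simp: rep_def)
qed

lemma state_Cons:
  "state k B = (0 \<in> B, rep B (Suc k)) # map (\<lambda>i. (i \<in> B, rep B (Suc k + i))) [Suc 0..<Suc k]"
  unfolding state_def by (subst upt_conv_Cons) (simp_all del: upt_Suc)

text \<open>Adding k + 1 creates the sums k + 1 + i with i in B, and 2k + 2, which B alone cannot
  reach; the sum 2k + 3 stays out of reach either way. This accounts for the last two pairs that
  \<open>step\<close> produces.\<close>

lemma step_state:
  assumes "B \<subseteq> {..k}"
  shows "step True (0 \<in> B) (map (\<lambda>i. (i \<in> B, rep B (Suc k + i))) [Suc 0..<Suc k]) =
           state (Suc k) (insert (Suc k) B)"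
    and "step False (0 \<in> B) (map (\<lambda>i. (i \<in> B, rep B (Suc k + i))) [Suc 0..<Suc k]) =
           state (Suc k) B"
proof -
  have split: "state (Suc k) B' = map (\<lambda>i. (i \<in> B', rep B' (Suc k + Suc i))) [0..<k] @
     [(k \<in> B', rep B' (Suc k + Suc k)), (Suc k \<in> B', rep B' (Suc k + Suc (Suc k)))]" for B'
    by (simp add: state_def)
  have "rep (insert (Suc k) B) (Suc k + Suc k)" by (auto simp: rep_def)
  moreover have "\<not> rep (insert (Suc k) B) (Suc k + Suc (Suc k))"
    using rep_bounded[of "insert (Suc k) B" _ "Suc k"] assms by fastforce
  moreover have "\<not> rep B (Suc k + Suc k)" "\<not> rep B (Suc k + Suc (Suc k))"
    using rep_bounded[of B _ k] assms by fastforce+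
  moreover have "Suc k \<notin> B" using assms by auto
  ultimately show "step True (0 \<in> B) (map (\<lambda>i. (i \<in> B, rep B (Suc k + i))) [Suc 0..<Suc k]) =
           state (Suc k) (insert (Suc k) B)"
    "step False (0 \<in> B) (map (\<lambda>i. (i \<in> B, rep B (Suc k + i))) [Suc 0..<Suc k]) =
           state (Suc k) B"
    using rep_insert_Suc[OF assms]
    unfolding split step_map[OF le0, of _ "\<lambda>i. i \<in> B"] by (auto simp del: add_Suc_right)
qed

text \<open>Induction on the depth, splitting the fibre at each level by
  \<open>fibre_Suc\<close>.\<close>

lemma tree_state:
  "B \<in> bases k \<Longrightarrow> tree f d (state k B) = (\<Sum>C\<in>fibre (k + d) k B. f (state (k + d) C))"
proof (induction d arbitrary: k B)
  case 0
  then show ?case by (simp add: fibre_self)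
next
  case (Suc d)
  have B: "B \<subseteq> {..k}" using Suc.prems by (auto simp: bases_def)
  let ?n = "Suc k + d"
  note fib = fibre_Suc[OF Suc.prems, of ?n]
  have "tree f (Suc d) (state k B) = tree f d (state (Suc k) (insert (Suc k) B)) +
          (if rep B (Suc k) then tree f d (state (Suc k) B) else 0)"
    unfolding state_Cons tree.simps step_state[OF B] ..
  also have "\<dots> = (\<Sum>C\<in>fibre ?n (Suc k) (insert (Suc k) B). f (state ?n C)) +
          (\<Sum>C\<in>fibre ?n (Suc k) B. f (state ?n C))"
    using Suc.IH[OF insert_bases[OF Suc.prems]] Suc.IH[of B "Suc k"] fib(3,4) by auto
  also have "\<dots> = (\<Sum>C\<in>fibre ?n k B. f (state ?n C))"
    using fib(1,2) by (simp add: sum.union_disjoint[symmetric] finite_fibre)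
  finally show ?case by simp
qed

text \<open>The root \<open>[(True, False)]\<close> encodes {0} at k = 0: it contains 0, and 1 is
  not a sum.\<close>

lemma tree_bases:
  "tree f k [(True, False)] = (\<Sum>C\<in>bases k. f (state k C))"
proof -
  have b0: "{0} \<in> bases 0" by (auto simp: bases_def rep_def)
  have s0: "state 0 {0} = [(True, False)]" by (simp add: state_def rep_def)
  have f0: "fibre k 0 {0} = bases k" by (auto simp: fibre_def bases_def)
  show ?thesis using tree_state[OF b0, of f k] by (simp add: s0 f0)
qed

section \<open>The upper bound\<close>

text \<open>Bit \<open>t\<close> of \<open>u\<close> tells whether \<open>k + 1 + t\<close> belongs to the set. The list \<open>Z\<close> is a reversed prefix
  \<open>[i \<in> C, \<dots>, 0 \<in> C]\<close>, and \<open>miss Z u\<close> means that \<open>k + 1 + i\<close> is not the sum of an element of \<open>C\<close>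
  and one above \<open>k\<close>.\<close>

fun miss :: "bool list \<Rightarrow> bool list \<Rightarrow> bool" where
  "miss [] u = True"
| "miss (z # Z) [] = True"
| "miss (z # Z) (v # u) = (\<not> (z \<and> v) \<and> miss Z u)"

text \<open>A power of 2 with one factor for each bit that neither failure forces to be False: the
  number of bit strings in both failures. Z may run out first, being an earlier and shorter prefix.
  The type \<open>num\<close> lets rewriting build the binary numeral directly.\<close>

fun free_count :: "bool list \<Rightarrow> bool list \<Rightarrow> num" where
  "free_count Z [] = num.One"
| "free_count [] (b # a) = (if b then free_count [] a else num.Bit0 (free_count [] a))"
| "free_count (c # Z) (b # a) = (if c \<or> b then free_count Z a else num.Bit0 (free_count Z a))"

text \<open>The second-order Bonferroni term: started at the size v of the new failure, it subtracts
  the overlaps with the failures already counted.\<close>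

fun gain :: "bool list \<Rightarrow> bool list list \<Rightarrow> int \<Rightarrow> int" where
  "gain a [] v = v"
| "gain a (Z # Zs) v = gain a Zs (v - numeral (free_count Z a))"

text \<open>\<open>Zs\<close> holds the failures counted so far, and \<open>v\<close> bounds the number of bit strings of length
  \<open>length a\<close> which avoid all of them. A failure whose Bonferroni term \<open>g\<close> is not positive is dropped.\<close>

fun upper :: "(bool \<times> bool) list \<Rightarrow> bool list \<Rightarrow> bool list list \<Rightarrow> int \<Rightarrow> int" where
  "upper [] a Zs v = v"
| "upper ((b, r) # x) a Zs v =
    (let g = gain (b # a) Zs (numeral (free_count [] (b # a))) in
     if r \<or> g \<le> 0 then upper x (b # a) Zs (2 * v)
     else upper x (b # a) ((b # a) # Zs) (2 * v - g))"

definition leaf_upper :: "(bool \<times> bool) list \<Rightarrow> int" where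
  "leaf_upper x = upper x [] [] 1"

section \<open>Counting bit strings that avoid failures\<close>

lemma miss_iff: "miss Z u \<longleftrightarrow> (\<forall>t. t < length Z \<and> t < length u \<longrightarrow> \<not> (Z ! t \<and> u ! t))"
proof (induction Z u rule: miss.induct)
  case (3 z Z v u)
  show ?case
    unfolding miss.simps 3 by (auto simp: nth_Cons' less_Suc_eq_0_disj split: if_splits)
qed auto

lemma miss_append: "length Z \<le> length u \<Longrightarrow> miss Z (u @ w) = miss Z u"
  by (induction Z u rule: miss.induct) auto

lemma finite_bool_lists: "finite {u :: bool list. length u = n \<and> P u}"
  by (rule finite_subset[OF _ finite_lists_length_eq[of UNIV n]]) auto

lemma card_bool_lists_Cons:
  "card {u :: bool list. length u = Suc n \<and> P u} =
     card {u. length u = n \<and> P (True # u)} + card {u. length u = n \<and> P (False # u)}"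
proof -
  have "{u. length u = Suc n \<and> P u} =
     Cons True ` {u. length u = n \<and> P (True # u)} \<union> Cons False ` {u. length u = n \<and> P (False # u)}"
    (is "?A = ?B")
  proof (rule set_eqI)
    fix u show "u \<in> ?A \<longleftrightarrow> u \<in> ?B"
    proof (cases u)
      case (Cons v w)
      then show ?thesis by (cases v) auto
    qed auto
  qed
  also have "card \<dots> = card {u. length u = n \<and> P (True # u)} + card {u. length u = n \<and> P (False # u)}"
    by (subst card_Un_disjoint) (auto simp: finite_bool_lists card_image)
  finally show ?thesis .
qed

lemma card_bool_lists_snoc:
  "card {u :: bool list. length u = Suc n \<and> P u} =
     card {u. length u = n \<and> P (u @ [True])} + card {u. length u = n \<and> P (u @ [False])}"
proof -
  let ?X = "\<lambda>v. {u. length u = n \<and> P (u @ [v])}"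
  let ?f = "\<lambda>v u. u @ [v]"
  have "{u. length u = Suc n \<and> P u} = ?f True ` ?X True \<union> ?f False ` ?X False" (is "?A = ?B")
  proof (rule set_eqI)
    fix u show "u \<in> ?A \<longleftrightarrow> u \<in> ?B"
    proof (cases u rule: rev_cases)
      case (snoc w v)
      then show ?thesis by (cases v) (simp_all add: image_iff)
    qed (simp add: image_iff)
  qed
  moreover have "?f True ` ?X True \<inter> ?f False ` ?X False = {}"
    by (intro equals0I, elim IntE imageE) simp
  moreover have "card (?f v ` ?X v) = card (?X v)" for v
    by (rule card_image) (simp add: inj_on_def)
  ultimately show ?thesis
    by (simp only: card_Un_disjoint finite_imageI finite_bool_lists)
qed

lemma free_count_eq:
  "length Z \<le> length a \<Longrightarrow>
   numeral (free_count Z a) = card {u. length u = length a \<and> miss Z u \<and> miss a u}"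
proof (induction Z a rule: free_count.induct)
  case (1 Z)
  then have "{u. length u = length ([]::bool list) \<and> miss Z u \<and> miss [] u} = {[]}" by auto
  then show ?case by simp
next
  case (2 b a)
  then show ?case
    by (cases b) (simp_all add: card_bool_lists_Cons numeral_Bit0)
next
  case (3 c Z b a)
  then show ?case
    by (cases b; cases c) (simp_all add: card_bool_lists_Cons numeral_Bit0)
qed

lemma gain_eq: "gain a Zs v = v - (\<Sum>Z\<leftarrow>Zs. numeral (free_count Z a))"
  by (induction Zs arbitrary: v) auto

text \<open>The full condition on the bits u that \<open>upper\<close> relaxes: no sum k + 1 + i
  lacking in C + C may be missed. The accumulator is the reversed prefix, as in
  \<open>upper\<close>.\<close>

fun admissible :: "(bool \<times> bool) list \<Rightarrow> bool list \<Rightarrow> bool list \<Rightarrow> bool" where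
  "admissible [] a u = True"
| "admissible ((b, r) # x) a u = ((r \<or> \<not> miss (b # a) u) \<and> admissible x (b # a) u)"

lemma card_union_bound:
  fixes Zs :: "bool list list"
  shows "card {u. length u = n \<and> (\<exists>Z\<in>set Zs. miss Z u) \<and> P u} \<le>
    (\<Sum>Z\<leftarrow>Zs. card {u. length u = n \<and> miss Z u \<and> P u})"
proof (induction Zs)
  case (Cons Z Zs)
  have "{u. length u = n \<and> (\<exists>Z\<in>set (Z # Zs). miss Z u) \<and> P u} =
    {u. length u = n \<and> miss Z u \<and> P u} \<union> {u. length u = n \<and> (\<exists>Z\<in>set Zs. miss Z u) \<and> P u}"
    by auto
  then show ?case
    using Cons card_Un_le[of "{u. length u = n \<and> miss Z u \<and> P u}"
        "{u. length u = n \<and> (\<exists>Z\<in>set Zs. miss Z u) \<and> P u}"] by simp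
qed simp

text \<open>The strings removed by the new failure are those missing a but no earlier Z. By the
  union bound at most the sum of the pairwise overlaps is lost from the strings missing a.\<close>

lemma card_miss_gain:
  assumes "\<forall>Z\<in>set Zs. length Z \<le> length a"
  shows "int (card {u. length u = length a \<and> (\<forall>Z\<in>set Zs. \<not> miss Z u) \<and> \<not> miss a u}) \<le>
     int (card {u. length u = length a \<and> (\<forall>Z\<in>set Zs. \<not> miss Z u)}) -
     gain a Zs (numeral (free_count [] a))"
proof -
  let ?S = "\<lambda>P. {u :: bool list. length u = length a \<and> P u}"
  let ?A = "\<lambda>u. \<forall>Z\<in>set Zs. \<not> miss Z u"
  have "?S ?A = ?S (\<lambda>u. ?A u \<and> \<not> miss a u) \<union> ?S (\<lambda>u. ?A u \<and> miss a u)" by blast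
  then have "card (?S ?A) = card (?S (\<lambda>u. ?A u \<and> \<not> miss a u) \<union> ?S (\<lambda>u. ?A u \<and> miss a u))"
    by (rule arg_cong)
  also have "\<dots> = card (?S (\<lambda>u. ?A u \<and> \<not> miss a u)) + card (?S (\<lambda>u. ?A u \<and> miss a u))"
    by (intro card_Un_disjoint finite_bool_lists) blast
  finally have 1: "card (?S ?A) = \<dots>" .
  have "?S (miss a) = ?S (\<lambda>u. ?A u \<and> miss a u) \<union> ?S (\<lambda>u. (\<exists>Z\<in>set Zs. miss Z u) \<and> miss a u)" by blast
  then have "card (?S (miss a)) =
      card (?S (\<lambda>u. ?A u \<and> miss a u) \<union> ?S (\<lambda>u. (\<exists>Z\<in>set Zs. miss Z u) \<and> miss a u))"
    by (rule arg_cong)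
  also have "\<dots> \<le> card (?S (\<lambda>u. ?A u \<and> miss a u)) + card (?S (\<lambda>u. (\<exists>Z\<in>set Zs. miss Z u) \<and> miss a u))"
    by (rule card_Un_le)
  also have "\<dots> \<le> card (?S (\<lambda>u. ?A u \<and> miss a u)) + (\<Sum>Z\<leftarrow>Zs. card (?S (\<lambda>u. miss Z u \<and> miss a u)))"
    by (intro add_left_mono card_union_bound)
  also have "(\<Sum>Z\<leftarrow>Zs. card (?S (\<lambda>u. miss Z u \<and> miss a u))) = (\<Sum>Z\<leftarrow>Zs. numeral (free_count Z a))"
    using assms by (intro arg_cong[of _ _ sum_list] map_cong[OF refl] free_count_eq[symmetric]) blast
  finally have 2: "card (?S (miss a)) \<le> card (?S (\<lambda>u. ?A u \<and> miss a u)) +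
      (\<Sum>Z\<leftarrow>Zs. numeral (free_count Z a))" .
  have 3: "numeral (free_count [] a) = card (?S (miss a))"
    using free_count_eq[of "[]" a] by simp
  have 4: "int (\<Sum>Z\<leftarrow>Zs. numeral (free_count Z a)) = (\<Sum>Z\<leftarrow>Zs. numeral (free_count Z a))"
    by (induction Zs) auto
  have 5: "int (card (?S (miss a))) = numeral (free_count [] a)"
    using 3 by (metis of_nat_numeral)
  show ?thesis
    using 2[folded of_nat_le_iff[where 'a = int]]
    unfolding gain_eq 1 of_nat_add 4 5 by linarith
qed

text \<open>The second hypothesis is the invariant of the recursion. Forgetting a failure only
  enlarges the set counted, so skipping those with nonpositive gain is sound.\<close>

lemma upper_bound:
  assumes "\<forall>Z\<in>set Zs. length Z \<le> length a"
    and "int (card {u. length u = length a \<and> (\<forall>Z\<in>set Zs. \<not> miss Z u)}) \<le> v"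
  shows "int (card {u. length u = length a + length x \<and> (\<forall>Z\<in>set Zs. \<not> miss Z u) \<and> admissible x a u})
      \<le> upper x a Zs v"
  using assms
proof (induction x arbitrary: a Zs v)
  case Nil
  then show ?case by simp
next
  case (Cons br x)
  obtain b r where br: "br = (b, r)" by fastforce
  let ?a = "b # a"
  let ?g = "gain ?a Zs (numeral (free_count [] ?a))"
  have len: "\<forall>Z\<in>set Zs. length Z \<le> length ?a" using Cons.prems by auto
  \<comment> \<open>Counted failures constrain only the first \<open>length a\<close> bits, so one
    more bit is free and doubles the count.\<close>
  have snoc: "(length u = length a \<and> (\<forall>Z\<in>set Zs. \<not> miss Z (u @ [c]))) \<longleftrightarrow>
      (length u = length a \<and> (\<forall>Z\<in>set Zs. \<not> miss Z u))" for u c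
    using Cons.prems(1) by (auto simp: miss_append)
  have dbl: "int (card {u. length u = length ?a \<and> (\<forall>Z\<in>set Zs. \<not> miss Z u)}) \<le> 2 * v"
    using Cons.prems(2) by (simp only: list.size(4) add_0_right add_Suc_right One_nat_def
        card_bool_lists_snoc snoc)
  show ?case
  proof (cases "r \<or> ?g \<le> 0")
    case True
    have "int (card {u. length u = length a + length (br # x) \<and> (\<forall>Z\<in>set Zs. \<not> miss Z u) \<and>
           admissible (br # x) a u}) \<le>
      int (card {u. length u = length ?a + length x \<and> (\<forall>Z\<in>set Zs. \<not> miss Z u) \<and>
           admissible x ?a u})"
      by (intro zle_int[THEN iffD2] card_mono finite_bool_lists) (auto simp: br)
    also have "\<dots> \<le> upper x ?a Zs (2 * v)" by (rule Cons.IH[OF len dbl])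
    finally show ?thesis using True by (auto simp: br Let_def)
  next
    case False
    have eq: "{u. length u = length ?a \<and> (\<forall>Z\<in>set (?a # Zs). \<not> miss Z u)} =
        {u. length u = length ?a \<and> (\<forall>Z\<in>set Zs. \<not> miss Z u) \<and> \<not> miss ?a u}" by auto
    have new: "int (card {u. length u = length ?a \<and> (\<forall>Z\<in>set (?a # Zs). \<not> miss Z u)}) \<le> 2 * v - ?g"
      unfolding eq using card_miss_gain[OF len] dbl by linarith
    have "int (card {u. length u = length a + length (br # x) \<and> (\<forall>Z\<in>set Zs. \<not> miss Z u) \<and>
           admissible (br # x) a u}) \<le>
      int (card {u. length u = length ?a + length x \<and> (\<forall>Z\<in>set (?a # Zs). \<not> miss Z u) \<and>
           admissible x ?a u})"
      using False by (intro zle_int[THEN iffD2] card_mono finite_bool_lists) (auto simp: br)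
    also have "\<dots> \<le> upper x ?a (?a # Zs) (2 * v - ?g)"
      using len by (intro Cons.IH new) auto
    finally show ?thesis using False by (auto simp: br Let_def)
  qed
qed

section \<open>From extensions of a trace to admissible bit strings\<close>

lemma admissible_map:
  assumes "j \<le> n"
  shows "admissible (map (\<lambda>i. (\<beta> i, \<rho> i)) [j..<n]) (rev (map \<beta> [0..<j])) u \<longleftrightarrow>
    (\<forall>i. j \<le> i \<and> i < n \<longrightarrow> \<rho> i \<or> \<not> miss (rev (map \<beta> [0..<Suc i])) u)"
  using assms
proof (induction rule: inc_induct)
  case base
  have "[n..<n] = []" by simp
  then show ?case by (simp only: list.map admissible.simps) force
next
  case (step j)
  have n: "[j..<n] = j # [Suc j..<n]" using step(2) by (simp add: upt_conv_Cons)
  have r: "\<beta> j # rev (map \<beta> [0..<j]) = rev (map \<beta> [0..<Suc j])" by simp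
  have "admissible (map (\<lambda>i. (\<beta> i, \<rho> i)) [j..<n]) (rev (map \<beta> [0..<j])) u \<longleftrightarrow>
    (\<rho> j \<or> \<not> miss (rev (map \<beta> [0..<Suc j])) u) \<and>
    (\<forall>i. Suc j \<le> i \<and> i < n \<longrightarrow> \<rho> i \<or> \<not> miss (rev (map \<beta> [0..<Suc i])) u)"
    unfolding n list.map admissible.simps r step.IH ..
  also have "\<dots> \<longleftrightarrow> (\<forall>i. j \<le> i \<and> i < n \<longrightarrow> \<rho> i \<or> \<not> miss (rev (map \<beta> [0..<Suc i])) u)"
  proof -
    have "j \<le> i \<and> i < n \<longleftrightarrow> i = j \<or> Suc j \<le> i \<and> i < n" for i using step(2) by auto
    then show ?thesis by (simp only:) blast
  qed
  finally show ?case .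
qed

text \<open>An extension S is encoded by its bits on {k+1..2k+1}. Two elements above k add up to at
  least 2k + 2, so a sum k + 1 + i with i \<le> k that is not in C + C needs exactly one summand
  above k; hence the code is admissible.\<close>

lemma card_fibre_le_leaf_upper:
  assumes C: "C \<in> bases k"
  shows "int (card (fibre (2 * k + 1) k C)) \<le> leaf_upper (state k C)"
proof -
  let ?enc = "\<lambda>S. map (\<lambda>t. Suc k + t \<in> S) [0..<Suc k]"
  let ?T = "{u. length u = Suc k \<and> admissible (state k C) [] u}"
  have inj: "inj_on ?enc (fibre (2 * k + 1) k C)"
  proof (rule inj_onI, rule set_eqI)
    fix S T x
    assume S: "S \<in> fibre (2 * k + 1) k C" and T: "T \<in> fibre (2 * k + 1) k C" and eq: "?enc S = ?enc T"
    consider "x \<le> k" | "k < x" "x \<le> 2 * k + 1" | "x > 2 * k + 1" by linarith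
    then show "x \<in> S \<longleftrightarrow> x \<in> T"
    proof cases
      case 1
      then show ?thesis using S T unfolding fibre_def by blast
    next
      case 2
      have "?enc S ! (x - Suc k) = ?enc T ! (x - Suc k)" by (simp only: eq)
      then show ?thesis using 2 by (simp del: upt_Suc)
    next
      case 3
      then have "x \<notin> {..2 * k + 1}" by simp
      then show ?thesis using S T unfolding fibre_def bases_def by blast
    qed
  qed
  have "?enc S \<in> ?T" if S: "S \<in> fibre (2 * k + 1) k C" for S
  proof -
    have "rep C (Suc k + i) \<or> \<not> miss (rev (map (\<lambda>i. i \<in> C) [0..<Suc i])) (?enc S)" if i: "i \<le> k" for i
    proof (rule disjCI)
      assume ms: "\<not> \<not> miss (rev (map (\<lambda>i. i \<in> C) [0..<Suc i])) (?enc S)"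
      have m: "\<not> (i - t \<in> C \<and> Suc k + t \<in> S)" if t: "t \<le> i" for t
      proof -
        have "t < length (rev (map (\<lambda>i. i \<in> C) [0..<Suc i]))" "t < length (?enc S)"
          using t i by simp_all
        then have "\<not> (rev (map (\<lambda>i. i \<in> C) [0..<Suc i]) ! t \<and> ?enc S ! t)"
          using ms unfolding miss_iff by blast
        moreover have "rev (map (\<lambda>i. i \<in> C) [0..<Suc i]) ! t \<longleftrightarrow> i - t \<in> C"
        proof -
          have "[0..<Suc i] ! (i - t) = i - t" by (subst nth_upt) auto
          then show ?thesis using t by (simp add: rev_nth del: upt_Suc)
        qed
        moreover have "?enc S ! t \<longleftrightarrow> Suc k + t \<in> S"
          using t i by (simp del: upt_Suc)
        ultimately show ?thesis by blast
      qed
      have low: "x \<in> C" if "x \<in> S" "x \<le> k" for x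
        using S that unfolding fibre_def by blast
      have "rep S (Suc k + i)" using S i by (auto simp: fibre_def bases_def)
      then obtain j where j: "j \<in> S" "Suc k + i - j \<in> S" "j \<le> Suc k + i" by (auto simp: rep_def)
      show "rep C (Suc k + i)"
      proof (cases "j \<le> k \<and> Suc k + i - j \<le> k")
        case True
        then show ?thesis using j low unfolding rep_def by blast
      next
        case False
        show ?thesis
        proof (cases "j \<le> k")
          case True
          then have "j \<le> i" "Suc k + i - j = Suc k + (i - j)" using False i by auto
          then have "Suc k + (i - j) \<in> S" "i - (i - j) \<in> C" using j low True by auto
          then show ?thesis using m[of "i - j"] by auto
        next
          case jk: False
          define t where "t = j - Suc k"
          have t: "j = Suc k + t" "t \<le> i" "Suc k + i - j = i - t"
            using jk j(3) by (auto simp: t_def)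
          then have "i - t \<in> C" using j(2) i by (intro low) auto
          then show ?thesis using m[OF t(2)] j(1) t(1) by blast
        qed
      qed
    qed
    then have "admissible (state k C) (rev (map (\<lambda>i. i \<in> C) [0..<0])) (?enc S)"
      unfolding state_def by (subst admissible_map) (use less_Suc_eq_le in blast)+
    then show ?thesis by simp
  qed
  then have "card (fibre (2 * k + 1) k C) \<le> card ?T"
    by (intro card_inj_on_le[OF inj _ finite_bool_lists] image_subsetI)
  also have "int (card ?T) \<le> leaf_upper (state k C)"
  proof -
    have "length (state k C) = Suc k" by (simp add: state_def)
    then show ?thesis using upper_bound[of "[]" "[]" 1 "state k C"] by (simp add: leaf_upper_def)
  qed
  finally show ?thesis by simp
qed

lemma density_upper:
  "density (2 * k + 1) \<le> tree leaf_upper k [(True, False)] / 2 ^ (2 * k + 1)"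
proof -
  have "int (card (bases (2 * k + 1))) = (\<Sum>C\<in>bases k. int (card (fibre (2 * k + 1) k C)))"
    by (subst card_bases_fibre[of k]) auto
  also have "\<dots> \<le> tree leaf_upper k [(True, False)]"
    unfolding tree_bases by (intro sum_mono card_fibre_le_leaf_upper)
  finally have "real_of_int (int (card (bases (2 * k + 1)))) \<le> real_of_int (tree leaf_upper k [(True, False)])"
    by (simp only: of_int_le_iff)
  then show ?thesis unfolding density_def by (intro divide_right_mono) auto
qed

section \<open>The lower bound\<close>

text \<open>The factor 7 is the sum of \<open>(3/4) ^ ((m - 1) div 2 - k)\<close> over \<open>m \<ge> 2k + 2\<close>: such an \<open>m\<close> is not
  represented only if \<open>m - C\<close> is avoided and none of the pairs \<open>{j, m - j}\<close> with \<open>k < j < m - j\<close> is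
  contained in the set.\<close>

fun lower :: "(bool \<times> bool) list \<Rightarrow> bool list \<Rightarrow> int \<Rightarrow> int" where
  "lower [] a v = v - 7 * numeral (free_count [] a)"
| "lower ((b, r) # x) a v =
    lower x (b # a) (if r then 2 * v else 2 * v - numeral (free_count [] (b # a)))"

definition leaf_lower :: "(bool \<times> bool) list \<Rightarrow> int" where
  "leaf_lower x = lower x [] 1"

lemma free_count_indicator:
  "(numeral (free_count [] (rev (map (\<lambda>j. j \<in> C) [0..<m]))) :: real) = 2 ^ m / 2 ^ card {j \<in> C. j < m}"
proof (induction m)
  case (Suc m)
  let ?a = "rev (map (\<lambda>j. j \<in> C) [0..<m])"
  have a: "rev (map (\<lambda>j. j \<in> C) [0..<Suc m]) = (m \<in> C) # ?a" by simp
  show ?case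
  proof (cases "m \<in> C")
    case True
    then have e: "{j \<in> C. j < Suc m} = insert m {j \<in> C. j < m}" by auto
    have "card {j \<in> C. j < Suc m} = Suc (card {j \<in> C. j < m})" unfolding e by simp
    moreover have "free_count [] ((m \<in> C) # ?a) = free_count [] ?a"
      using True by (simp only: free_count.simps if_True)
    ultimately show ?thesis unfolding a by (simp only: Suc.IH) simp
  next
    case False
    then have "{j \<in> C. j < Suc m} = {j \<in> C. j < m}" using less_Suc_eq by auto
    moreover have "free_count [] ((m \<in> C) # ?a) = num.Bit0 (free_count [] ?a)"
      using False by (simp only: free_count.simps if_False)
    ultimately show ?thesis unfolding a by (simp only: numeral_Bit0 Suc.IH) simp
  qed
qed simp

text \<open>After j bits the accumulator carries the scale \<open>2 ^ j\<close>. Unscaled, the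
  recursion is a union bound: 1 minus the probabilities of the near failures, minus the bound for
  all far ones.\<close>

lemma lower_eq:
  assumes "j \<le> n"
  shows "real_of_int (lower (map (\<lambda>i. (i \<in> C, \<rho> i)) [j..<n]) (rev (map (\<lambda>i. i \<in> C) [0..<j])) v) =
    2 ^ n * (v / 2 ^ j - (\<Sum>i\<in>{j..<n}. if \<rho> i then 0 else 1 / 2 ^ card {l \<in> C. l < Suc i})
             - 7 / 2 ^ card {l \<in> C. l < n})"
  using assms
proof (induction arbitrary: v rule: inc_induct)
  case base
  have "[n..<n] = []" "{n..<n} = {}" by simp_all
  then show ?case
    by (simp only: list.map lower.simps of_int_diff of_int_mult of_int_numeral free_count_indicator
        sum.empty) (simp add: field_simps)
next
  case (step j)
  have n: "[j..<n] = j # [Suc j..<n]" using step(2) by (simp add: upt_conv_Cons)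
  have r: "(j \<in> C) # rev (map (\<lambda>i. i \<in> C) [0..<j]) = rev (map (\<lambda>i. i \<in> C) [0..<Suc j])" by simp
  have sum: "(\<Sum>i\<in>{j..<n}. h i) = h j + (\<Sum>i\<in>{Suc j..<n}. h i)" for h :: "nat \<Rightarrow> real"
    using step(2) by (rule sum.atLeast_Suc_lessThan)
  let ?v = "if \<rho> j then 2 * v else 2 * v - numeral (free_count [] (rev (map (\<lambda>i. i \<in> C) [0..<Suc j])))"
  have v: "real_of_int ?v / 2 ^ Suc j =
      v / 2 ^ j - (if \<rho> j then 0 else 1 / 2 ^ card {l \<in> C. l < Suc j})"
  proof (cases "\<rho> j")
    case False
    then have v: "real_of_int ?v = 2 * real_of_int v - 2 ^ Suc j / 2 ^ card {l \<in> C. l < Suc j}"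
      by (simp only: if_False of_int_diff of_int_mult of_int_numeral free_count_indicator)
    have "(2 * real_of_int v - 2 ^ Suc j / 2 ^ card {l \<in> C. l < Suc j}) / 2 ^ Suc j =
        v / 2 ^ j - 1 / 2 ^ card {l \<in> C. l < Suc j}"
      by (simp add: diff_divide_distrib)
    then show ?thesis unfolding v using False by (simp only: if_False)
  qed simp
  show ?case
    unfolding n list.map lower.simps r step.IH v sum by (simp only: diff_diff_eq)
qed

text \<open>The pairs {j, f j} are disjoint and each allows 3 of its 4 subsets; the induction
  removes one pair from V at a time.\<close>

lemma card_avoid_pairs:
  assumes "finite J" "finite V" "J \<subseteq> V" "f ` J \<subseteq> V" "inj_on f J" "J \<inter> f ` J = {}"
  shows "real (card {u. u \<subseteq> V \<and> (\<forall>j\<in>J. \<not> (j \<in> u \<and> f j \<in> u))}) \<le> 2 ^ card V * (3 / 4) ^ card J"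
  using assms
proof (induction J arbitrary: V rule: finite_induct)
  case empty
  have "{u. u \<subseteq> V \<and> (\<forall>j\<in>{}. \<not> (j \<in> u \<and> f j \<in> u))} = Pow V" by auto
  then show ?case using empty.prems by (simp add: card_Pow)
next
  case (insert j J)
  let ?D = "\<lambda>V J. {u. u \<subseteq> V \<and> (\<forall>j\<in>J. \<not> (j \<in> u \<and> f j \<in> u))}"
  let ?p = "{j, f j}"
  let ?W = "V - ?p"
  have jf: "j \<noteq> f j" "j \<in> V" "f j \<in> V" using insert.prems by auto
  have "j \<notin> f ` J" "f j \<notin> J" using insert.prems(5) by auto
  moreover have "f j \<notin> f ` J" using insert.prems(4) insert.hyps by simp
  moreover have "J \<subseteq> V" "f ` J \<subseteq> V" using insert.prems by simp_all
  ultimately have "J \<subseteq> ?W" "f ` J \<subseteq> ?W" using insert.hyps by blast+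
  moreover have "finite ?W" "inj_on f J" using insert.prems by simp_all
  moreover have "J \<inter> f ` J = {}" using insert.prems(5) by blast
  ultimately have W: "finite ?W" "J \<subseteq> ?W" "f ` J \<subseteq> ?W" "inj_on f J" "J \<inter> f ` J = {}"
    by simp_all
  have "card (?D V (insert j J)) \<le> card ({{}, {j}, {f j}} \<times> ?D ?W J)"
  proof (rule card_inj_on_le)
    show "inj_on (\<lambda>u. (u \<inter> ?p, u - ?p)) (?D V (insert j J))"
      by (rule inj_onI) blast
    show "(\<lambda>u. (u \<inter> ?p, u - ?p)) ` ?D V (insert j J) \<subseteq> {{}, {j}, {f j}} \<times> ?D ?W J"
      by blast
    have "finite (?D ?W J)" by (rule finite_subset[of _ "Pow V"]) (use insert.prems in auto)
    then show "finite ({{}, {j}, {f j}} \<times> ?D ?W J)" by simp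
  qed
  also have "\<dots> \<le> 3 * card (?D ?W J)"
    by (simp add: card_cartesian_product card_insert_if)
  finally have "real (card (?D V (insert j J))) \<le> 3 * real (card (?D ?W J))" by linarith
  also have "\<dots> \<le> 3 * (2 ^ card ?W * (3 / 4) ^ card J)"
    using insert.IH[OF W] by linarith
  also have "\<dots> = 2 ^ card V * (3 / 4) ^ card (insert j J)"
  proof -
    have "card ?p \<le> card V" using insert.prems jf by (intro card_mono) auto
    moreover have "card ?W = card V - card ?p" using jf by (intro card_Diff_subset) auto
    ultimately have "card V = card ?W + card ?p" by linarith
    then have "card V = card ?W + 2" using jf(1) by simp
    then show ?thesis using insert.hyps by (simp add: power_add)
  qed
  finally show ?case .
qed

text \<open>Each l \<le> i in C forbids the point k + 1 + i - l, which lies above k. These points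
  are distinct, so each of them halves the number of choices for u.\<close>

lemma card_not_rep_near:
  assumes C: "C \<subseteq> {..k}" and i: "i \<le> k" and n: "Suc k + i \<le> n"
  shows "real (card {u \<in> Pow {Suc k..n}. \<not> rep (C \<union> u) (Suc k + i)}) \<le>
    (if rep C (Suc k + i) then 0 else 2 ^ (n - k) / 2 ^ card {l \<in> C. l < Suc i})"
proof (cases "rep C (Suc k + i)")
  case True
  then have e: "{u \<in> Pow {Suc k..n}. \<not> rep (C \<union> u) (Suc k + i)} = {}"
    using rep_mono by blast
  show ?thesis unfolding e using True by simp
next
  case False
  let ?C = "{l \<in> C. l < Suc i}"
  let ?Z = "(\<lambda>l. Suc k + i - l) ` ?C"
  have "inj_on (\<lambda>l. Suc k + i - l) ?C" by (auto intro!: inj_onI)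
  then have cZ: "card ?Z = card ?C" by (rule card_image)
  have Z: "?Z \<subseteq> {Suc k..n}" using n by auto
  then have le: "card ?C \<le> n - k" using card_mono[OF _ Z] cZ by simp
  have "{u \<in> Pow {Suc k..n}. \<not> rep (C \<union> u) (Suc k + i)} \<subseteq> Pow ({Suc k..n} - ?Z)"
  proof (intro subsetI PowI)
    fix u x assume u: "u \<in> {u \<in> Pow {Suc k..n}. \<not> rep (C \<union> u) (Suc k + i)}" and "x \<in> u"
    have "x \<notin> ?Z"
    proof
      assume "x \<in> ?Z"
      then obtain l where "l \<in> C" "l < Suc i" "x = Suc k + i - l" by blast
      moreover from this have "l \<le> Suc k + i" by simp
      ultimately show False using u \<open>x \<in> u\<close> unfolding rep_def by blast
    qed
    then show "x \<in> {Suc k..n} - ?Z" using u \<open>x \<in> u\<close> by blast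
  qed
  then have "card {u \<in> Pow {Suc k..n}. \<not> rep (C \<union> u) (Suc k + i)} \<le> card (Pow ({Suc k..n} - ?Z))"
    by (rule card_mono[rotated]) simp
  also have "\<dots> = 2 ^ (n - k - card ?C)"
    using card_Diff_subset[OF _ Z] cZ by (simp add: card_Pow)
  finally have "real (card {u \<in> Pow {Suc k..n}. \<not> rep (C \<union> u) (Suc k + i)}) \<le> real (2 ^ (n - k - card ?C))"
    by (simp only: of_nat_le_iff)
  also have "\<dots> = 2 ^ (n - k - card ?C)" by simp
  also have "(2::real) ^ (n - k - card ?C) = 2 ^ (n - k) / 2 ^ card ?C"
    by (rule power_diff[OF _ le]) simp
  finally show ?thesis using False by (simp only: if_False)
qed

text \<open>The forbidden points m - C are at least m - k, while the pairs {j, m - j} lie in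
  {k+1..m-k-1}. The two conditions concern disjoint points, so their factors multiply. The bound
  \<open>(m - 1) div 2\<close> leaves out j = m/2, which has no partner.\<close>

lemma card_not_rep_far:
  assumes C: "C \<subseteq> {..k}" and m: "2 * k + 2 \<le> m" and n: "m \<le> n"
  shows "real (card {u \<in> Pow {Suc k..n}. \<not> rep (C \<union> u) m}) \<le>
    2 ^ (n - k) / 2 ^ card C * (3 / 4) ^ ((m - 1) div 2 - k)"
proof -
  let ?Z = "(\<lambda>l. m - l) ` C"
  let ?V = "{Suc k..n} - ?Z"
  let ?J = "{Suc k..(m - 1) div 2}"
  let ?f = "\<lambda>j. m - j"
  have "inj_on ?f C"
    by (rule inj_onI) (use C m in force)
  then have cZ: "card ?Z = card C" by (rule card_image)
  have Z: "?Z \<subseteq> {Suc k..n}" using C m n by force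
  have le: "card C \<le> n - k" using card_mono[OF _ Z] cZ by simp
  have "finite ?Z" using Z by (rule finite_subset) simp
  then have cV: "card ?V = n - k - card C"
    using card_Diff_subset[OF _ Z] cZ by simp
  have J: "j \<in> ?V \<and> m - j \<in> ?V \<and> m - j \<notin> ?J \<and> j \<le> m" if "j \<in> ?J" for j
  proof -
    have j: "Suc k \<le> j" "2 * j < m" using that m by auto
    have "x \<noteq> m - l" if "l \<in> C" "x < m - k" for l x using that C by force
    moreover have "j < m - k" "m - j < m - k" using j m by auto
    moreover have "m - j > (m - 1) div 2" using j by linarith
    ultimately show ?thesis using j m n by auto
  qed
  have "real (card {u. u \<subseteq> ?V \<and> (\<forall>j\<in>?J. \<not> (j \<in> u \<and> ?f j \<in> u))}) \<le> 2 ^ card ?V * (3 / 4) ^ card ?J"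
  proof (rule card_avoid_pairs)
    show "inj_on ?f ?J" by (rule inj_onI) (use J in \<open>metis diff_diff_cancel\<close>)
    show "?J \<subseteq> ?V" using J by blast
    show "?f ` ?J \<subseteq> ?V" by (rule image_subsetI) (use J in blast)
    show "?J \<inter> ?f ` ?J = {}" by (rule equals0I, elim IntE imageE) (use J in blast)
  qed auto
  moreover have "{u \<in> Pow {Suc k..n}. \<not> rep (C \<union> u) m} \<subseteq>
      {u. u \<subseteq> ?V \<and> (\<forall>j\<in>?J. \<not> (j \<in> u \<and> ?f j \<in> u))}"
  proof (intro subsetI CollectI conjI ballI notI)
    fix u x assume u: "u \<in> {u \<in> Pow {Suc k..n}. \<not> rep (C \<union> u) m}" and "x \<in> u"
    have "x \<notin> ?Z"
    proof
      assume "x \<in> ?Z"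
      then obtain l where "l \<in> C" "x = m - l" by blast
      moreover have "l \<le> m" using \<open>l \<in> C\<close> C m by force
      ultimately show False using u \<open>x \<in> u\<close> unfolding rep_def by blast
    qed
    then show "x \<in> ?V" using u \<open>x \<in> u\<close> by blast
  next
    fix u j assume u: "u \<in> {u \<in> Pow {Suc k..n}. \<not> rep (C \<union> u) m}" and "j \<in> ?J" "j \<in> u \<and> m - j \<in> u"
    then show False using J[of j] unfolding rep_def by blast
  qed
  then have "card {u \<in> Pow {Suc k..n}. \<not> rep (C \<union> u) m} \<le>
      card {u. u \<subseteq> ?V \<and> (\<forall>j\<in>?J. \<not> (j \<in> u \<and> ?f j \<in> u))}"
    by (rule card_mono[rotated]) (rule finite_subset[of _ "Pow ?V"], blast, simp)
  then have "real (card {u \<in> Pow {Suc k..n}. \<not> rep (C \<union> u) m}) \<le>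
      real (card {u. u \<subseteq> ?V \<and> (\<forall>j\<in>?J. \<not> (j \<in> u \<and> ?f j \<in> u))})"
    by (simp only: of_nat_le_iff)
  moreover have "card ?J = (m - 1) div 2 - k" by simp
  moreover have "(2::real) ^ card ?V = 2 ^ (n - k) / 2 ^ card C"
    unfolding cV by (rule power_diff[OF _ le]) simp
  ultimately show ?thesis by (simp only:)
qed

lemma sum_far_le: "(\<Sum>m\<in>{2 * k + 2..n}. (3 / 4 :: real) ^ ((m - 1) div 2 - k)) \<le> 7"
proof -
  \<comment> \<open>The terms m = 2k + 2 + 2M and m + 1 have exponents M and M + 1 and together give
    7/4 times (3/4)^M, a geometric series with sum 7.\<close>
  have eq: "(\<Sum>m\<in>{2 * k + 2..<2 * k + 2 + 2 * M}. (3 / 4 :: real) ^ ((m - 1) div 2 - k)) = 7 - 7 * (3 / 4) ^ M" for M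
  proof (induction M)
    case (Suc M)
    have "{2 * k + 2..<2 * k + 2 + 2 * Suc M} =
        insert (2 * k + 2 + 2 * M) (insert (2 * k + 3 + 2 * M) {2 * k + 2..<2 * k + 2 + 2 * M})" by auto
    moreover have "(2 * k + 2 + 2 * M - 1) div 2 - k = M" "(2 * k + 3 + 2 * M - 1) div 2 - k = Suc M" by auto
    ultimately show ?case using Suc by simp
  qed simp
  have "(\<Sum>m\<in>{2 * k + 2..n}. (3 / 4 :: real) ^ ((m - 1) div 2 - k)) \<le>
      (\<Sum>m\<in>{2 * k + 2..<2 * k + 2 + 2 * n}. (3 / 4 :: real) ^ ((m - 1) div 2 - k))"
    by (rule sum_mono2) auto
  also have "\<dots> \<le> 7" unfolding eq by simp
  finally show ?thesis .
qed

text \<open>Union bound over the \<open>2 ^ (n - k)\<close> possible sets u of larger elements: u is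
  discarded once for each m in {k+1..n} that is not a sum. Near failures m = k + 1 + i with i \<le>
  k and far ones m \<ge> 2k + 2 are estimated separately.\<close>

lemma leaf_lower_le_card_fibre:
  assumes C: "C \<in> bases k" and n: "2 * k + 1 \<le> n"
  shows "2 ^ (n - k) * (leaf_lower (state k C) / 2 ^ Suc k) \<le> real (card (fibre n k C))"
proof -
  let ?V = "{Suc k..n}"
  let ?bad = "\<lambda>m. {u \<in> Pow ?V. \<not> rep (C \<union> u) m}"
  let ?good = "{u \<in> Pow ?V. \<forall>m\<in>?V. rep (C \<union> u) m}"
  let ?near = "\<Sum>i\<in>{0..<Suc k}. if rep C (Suc k + i) then 0 else 1 / 2 ^ card {l \<in> C. l < Suc i}"
  have Ck: "C \<subseteq> {..k}" "0 \<in> C" and Crep: "\<And>m. m \<le> k \<Longrightarrow> rep C m" using C by (auto simp: bases_def)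
  have "C \<union> u \<in> fibre n k C" if "u \<in> ?good" for u
  proof -
    have "rep (C \<union> u) m" if "m \<le> n" for m
      using that \<open>u \<in> ?good\<close> Crep[of m] rep_mono[of C m "C \<union> u"] by (cases "m \<le> k") auto
    moreover have "C \<union> u \<subseteq> {..n}" "0 \<in> C \<union> u" using Ck that n by force+
    moreover have "(C \<union> u) \<inter> {..k} = C" using Ck that by force
    ultimately show ?thesis unfolding fibre_def bases_def by blast
  qed
  moreover have "inj_on (\<lambda>u. C \<union> u) ?good"
  proof (rule inj_onI)
    fix u w assume "u \<in> ?good" "w \<in> ?good" "C \<union> u = C \<union> w"
    moreover have "C \<inter> ?V = {}" using Ck by force
    ultimately show "u = w" by blast
  qed
  ultimately have good: "card ?good \<le> card (fibre n k C)"
    by (intro card_inj_on_le[of "\<lambda>u. C \<union> u"]) (auto simp: finite_fibre)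
  have "Pow ?V = ?good \<union> (\<Union>m\<in>?V. ?bad m)" by blast
  then have "card (Pow ?V) = card (?good \<union> (\<Union>m\<in>?V. ?bad m))" by (rule arg_cong)
  also have "\<dots> \<le> card ?good + card (\<Union>m\<in>?V. ?bad m)" by (rule card_Un_le)
  also have "card (\<Union>m\<in>?V. ?bad m) \<le> (\<Sum>m\<in>?V. card (?bad m))"
    by (rule card_UN_le) simp
  finally have "2 ^ (n - k) \<le> card ?good + (\<Sum>m\<in>?V. card (?bad m))"
    by (simp add: card_Pow)
  then have "real (2 ^ (n - k)) \<le> real (card ?good + (\<Sum>m\<in>?V. card (?bad m)))"
    by (simp only: of_nat_le_iff)
  then have 1: "2 ^ (n - k) \<le> real (card (fibre n k C)) + (\<Sum>m\<in>?V. real (card (?bad m)))"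
    using good by simp
  have "?V = {Suc k + 0..<Suc k + Suc k} \<union> {2 * k + 2..n}" using n by auto
  then have "(\<Sum>m\<in>?V. real (card (?bad m))) =
      (\<Sum>m\<in>{Suc k + 0..<Suc k + Suc k}. real (card (?bad m))) + (\<Sum>m\<in>{2 * k + 2..n}. real (card (?bad m)))"
    by (simp only:) (rule sum.union_disjoint, auto)
  also have "(\<Sum>m\<in>{Suc k + 0..<Suc k + Suc k}. real (card (?bad m))) =
      (\<Sum>i\<in>{0..<Suc k}. real (card (?bad (Suc k + i))))"
    by (simp only: sum.shift_bounds_nat_ivl add.commute)
  also have "\<dots> \<le> (\<Sum>i\<in>{0..<Suc k}. 2 ^ (n - k) * (if rep C (Suc k + i) then 0 else 1 / 2 ^ card {l \<in> C. l < Suc i}))"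
  proof (rule sum_mono)
    fix i assume "i \<in> {0..<Suc k}"
    then have "real (card (?bad (Suc k + i))) \<le>
       (if rep C (Suc k + i) then 0 else 2 ^ (n - k) / 2 ^ card {l \<in> C. l < Suc i})"
      using Ck(1) n by (intro card_not_rep_near) auto
    then show "real (card (?bad (Suc k + i))) \<le>
       2 ^ (n - k) * (if rep C (Suc k + i) then 0 else 1 / 2 ^ card {l \<in> C. l < Suc i})"
      by (cases "rep C (Suc k + i)") simp_all
  qed
  also have "\<dots> = 2 ^ (n - k) * ?near" by (simp only: sum_distrib_left)
  also have "(\<Sum>m\<in>{2 * k + 2..n}. real (card (?bad m))) \<le>
      (\<Sum>m\<in>{2 * k + 2..n}. 2 ^ (n - k) / 2 ^ card C * (3 / 4) ^ ((m - 1) div 2 - k))"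
    using Ck(1) by (intro sum_mono card_not_rep_far) auto
  also have "\<dots> = 2 ^ (n - k) / 2 ^ card C * (\<Sum>m\<in>{2 * k + 2..n}. (3 / 4) ^ ((m - 1) div 2 - k))"
    by (simp only: sum_distrib_left)
  also have "\<dots> \<le> 2 ^ (n - k) / 2 ^ card C * 7"
    by (intro mult_left_mono sum_far_le) simp
  finally have 2: "(\<Sum>m\<in>?V. real (card (?bad m))) \<le> 2 ^ (n - k) * ?near + 2 ^ (n - k) / 2 ^ card C * 7"
    by simp
  have "{l \<in> C. l < Suc k} = C" using Ck by force
  then have "real_of_int (leaf_lower (state k C)) / 2 ^ Suc k = 1 - ?near - 7 / 2 ^ card C"
    using lower_eq[of 0 "Suc k" C "\<lambda>i. rep C (Suc k + i)" 1]
    unfolding leaf_lower_def state_def by (simp del: upt_Suc power_Suc sum.op_ivl_Suc)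
  then have "2 ^ (n - k) * (real_of_int (leaf_lower (state k C)) / 2 ^ Suc k) =
      2 ^ (n - k) - 2 ^ (n - k) * ?near - 2 ^ (n - k) / 2 ^ card C * 7"
    by (simp only: right_diff_distrib) simp
  then show ?thesis using 1 2 by linarith
qed

text \<open>The bound is uniform in n and so passes to the limit. Its exponent 2k + 1 joins the k
  free bits of C to the scale \<open>2 ^ Suc k\<close> of \<open>leaf_lower\<close>.\<close>

lemma density_lower:
  assumes "2 * k + 1 \<le> n"
  shows "tree leaf_lower k [(True, False)] / 2 ^ (2 * k + 1) \<le> density n"
proof -
  have "2 ^ (n - k) * (real_of_int (tree leaf_lower k [(True, False)]) / 2 ^ Suc k) =
      (\<Sum>C\<in>bases k. 2 ^ (n - k) * (leaf_lower (state k C) / 2 ^ Suc k))"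
    unfolding tree_bases of_int_sum by (simp add: sum_distrib_left sum_divide_distrib)
  also have "\<dots> \<le> (\<Sum>C\<in>bases k. real (card (fibre n k C)))"
    using assms by (intro sum_mono leaf_lower_le_card_fibre) auto
  also have "\<dots> = card (bases n)"
    using assms by (subst card_bases_fibre[of k]) auto
  finally have "2 ^ (n - k) * (real_of_int (tree leaf_lower k [(True, False)]) / 2 ^ Suc k) \<le> card (bases n)" .
  then have "2 ^ (n - k) * (real_of_int (tree leaf_lower k [(True, False)]) / 2 ^ Suc k) / 2 ^ n \<le> density n"
    unfolding density_def by (rule divide_right_mono) simp
  moreover have "(2::real) ^ n = 2 ^ (n - k) * 2 ^ k"
    using assms by (subst power_add[symmetric]) simp
  moreover have "(2::real) ^ (2 * k + 1) = 2 ^ Suc k * 2 ^ k"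
    by (subst power_add[symmetric]) (simp only: mult_2 add_Suc One_nat_def add_Suc_right add_0_right)
  ultimately show ?thesis by simp
qed

section \<open>Evaluation\<close>

text \<open>The rules below suffice to evaluate the trees by rewriting. The number 1 is kept in the form
  \<open>numeral num.One\<close>, so that every integer value is \<open>0\<close>, \<open>numeral n\<close> or \<open>- numeral n\<close>.\<close>

definition upper_step :: "int \<Rightarrow> (bool \<times> bool) list \<Rightarrow> bool list \<Rightarrow> bool list list \<Rightarrow> int \<Rightarrow> int" where
  "upper_step g x a Zs v = (if g \<le> 0 then upper x a Zs v else upper x a (a # Zs) (v - g))"

lemma step_eval:
  "step c b [] = [(b, c), (c, False)]"
  "step True b ((True, r) # x) = (b, True) # step True True x"
  "step True b ((False, True) # x) = (b, True) # step True False x"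
  "step True b ((False, False) # x) = (b, False) # step True False x"
  "step False b ((b', r) # x) = (b, r) # step False b' x"
  by simp_all

lemma tree_eval:
  "tree f 0 x = f x"
  "tree f (Suc d) ((b, True) # x) = tree f d (step True b x) + tree f d (step False b x)"
  "tree f (Suc d) ((b, False) # x) = tree f d (step True b x)"
  by simp_all

lemma free_count_eval:
  "free_count Z [] = num.One"
  "free_count [] (True # a) = free_count [] a"
  "free_count [] (False # a) = num.Bit0 (free_count [] a)"
  "free_count (True # Z) (b # a) = free_count Z a"
  "free_count (False # Z) (True # a) = free_count Z a"
  "free_count (False # Z) (False # a) = num.Bit0 (free_count Z a)"
  by simp_all

lemma leaf_upper_eval:
  "leaf_upper x = upper x [] [] (numeral num.One)"
  "upper [] a Zs v = v"
  "upper ((b, True) # x) a Zs v = upper x (b # a) Zs (2 * v)"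
  "upper ((b, False) # x) a Zs v =
     upper_step (gain (b # a) Zs (numeral (free_count [] (b # a)))) x (b # a) Zs (2 * v)"
  "upper_step 0 x a Zs v = upper x a Zs v"
  "upper_step (numeral n) x a Zs v = upper x a (a # Zs) (v - numeral n)"
  "upper_step (- numeral n) x a Zs v = upper x a Zs v"
  by (simp_all add: leaf_upper_def upper_step_def)

lemma leaf_lower_eval:
  "leaf_lower x = lower x [] (numeral num.One)"
  "lower [] a v = v - 7 * numeral (free_count [] a)"
  "lower ((b, True) # x) a v = lower x (b # a) (2 * v)"
  "lower ((b, False) # x) a v = lower x (b # a) (2 * v - numeral (free_count [] (b # a)))"
  by (simp_all add: leaf_lower_def)

text \<open>Multiplication by 7 is reduced to additions and binary shifts by 7n = n + 2(n +
  2n).\<close>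

lemma mult_eval:
  "2 * (0::int) = 0"
  "2 * (numeral n::int) = numeral (num.Bit0 n)"
  "2 * (- numeral n::int) = - numeral (num.Bit0 n)"
  "7 * (numeral n::int) = numeral (n + num.Bit0 (n + num.Bit0 n))"
  by (simp_all only: numeral_Bit0[of n] numeral_Bit0[of "n + num.Bit0 n"] numeral_add)

lemma add_eval:
  "0 - (numeral n::int) = - numeral n"
  "numeral m - (numeral n::int) = Num.sub m n"
  "- numeral m - (numeral n::int) = - numeral (m + n)"
  "0 + (x::int) = x"
  "x + (0::int) = x"
  "numeral m + (numeral n::int) = numeral (m + n)"
  "numeral m + (- numeral n::int) = Num.sub m n"
  "- numeral m + (numeral n::int) = Num.sub n m"
  "- numeral m + (- numeral n::int) = - numeral (m + n)"
  by simp_all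

lemma dbl_eval:
  "Num.dbl (0::int) = 0"
  "Num.dbl (numeral n::int) = numeral (num.Bit0 n)"
  "Num.dbl (- numeral n::int) = - numeral (num.Bit0 n)"
  "Num.dbl_inc (0::int) = numeral num.One"
  "Num.dbl_inc (numeral n::int) = numeral (num.Bit1 n)"
  "Num.dbl_inc (- numeral n::int) = - numeral (Num.BitM n)"
  "Num.dbl_dec (0::int) = - numeral num.One"
  "Num.dbl_dec (numeral n::int) = numeral (Num.BitM n)"
  "Num.dbl_dec (- numeral n::int) = - numeral (num.Bit1 n)"
  by simp_all

lemmas eval_rules = step_eval tree_eval free_count_eval gain.simps leaf_upper_eval leaf_lower_eval
  mult_eval add_eval dbl_eval sub_num_simps add_num_simps Num.BitM.simps

lemma tree_leaf_lower_13: "tree leaf_lower 13 [(True, False)] = 30491814"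
  unfolding eval_nat_numeral Num.BitM.simps One_nat_def by (simp only: eval_rules)

lemma tree_leaf_upper_17: "tree leaf_upper 17 [(True, False)] = 8120874609"
  unfolding eval_nat_numeral Num.BitM.simps One_nat_def by (simp only: eval_rules)

section \<open>The limit\<close>

text \<open>With h = (g - 1) div 2, the sets in \<open>S_sigma g\<close> and the possible traces on
  {0..h} have the same number \<open>2 ^ h\<close>.\<close>

lemma gamma_sigma_eq_density:
  assumes "g \<ge> 1"
  shows "gamma_sigma g = density ((g - 1) div 2)"
  using card_G_sigma[OF assms refl] by (simp add: gamma_sigma_def density_def)

lemma antimono_gamma_sigma: "antimono_on {1..} gamma_sigma"
proof (rule monotone_onI)
  fix x y :: nat assume "x \<in> {1..}" "y \<in> {1..}" "x \<le> y"
  then show "gamma_sigma x \<ge> gamma_sigma y"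
    by (simp add: gamma_sigma_eq_density decseqD[OF decseq_density] div_le_mono diff_le_mono)
qed

theorem mainTheorem2:
  shows "antimono_on {1..} gamma_sigma \<and>
    (\<exists>gamma_inf::real. gamma_sigma \<longlonglongrightarrow> gamma_inf \<and>
       \<bar>gamma_inf - 0.230653\<bar> \<le> 0.00579)"
proof -
  have "0 \<le> density n" for n by (simp add: density_def)
  then obtain L where L: "density \<longlonglongrightarrow> L" and L_le: "\<forall>n. L \<le> density n"
    using decseq_convergent[OF decseq_density] by blast
  have "filterlim (\<lambda>g::nat. (g - 1) div 2) sequentially sequentially"
    unfolding filterlim_at_top
  proof
    fix Z :: nat
    show "\<forall>\<^sub>F g in sequentially. Z \<le> (g - 1) div 2"
      by (rule eventually_sequentiallyI[of "2 * Z + 1"]) linarith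
  qed
  then have "(\<lambda>g. density ((g - 1) div 2)) \<longlonglongrightarrow> L"
    by (rule filterlim_compose[OF L])
  moreover have "\<forall>\<^sub>F g in sequentially. gamma_sigma g = density ((g - 1) div 2)"
    by (rule eventually_sequentiallyI[of 1]) (rule gamma_sigma_eq_density)
  ultimately have lim: "gamma_sigma \<longlonglongrightarrow> L"
    by (simp only: tendsto_cong)
  \<comment> \<open>A decreasing sequence stays above its limit, so one term suffices here. The
    quotient is about 0.23635, below 0.236443 = 0.230653 + 0.00579.\<close>
  have "L \<le> density (2 * 17 + 1)" using L_le by blast
  also have "\<dots> \<le> 8120874609 / 2 ^ (2 * 17 + 1)"
    using density_upper[of 17] unfolding tree_leaf_upper_17 by simp
  finally have "L \<le> 0.236443" by simp
  \<comment> \<open>From below a bound for all large n is required. The quotient is about 0.22718,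
    above 0.224863 = 0.230653 - 0.00579.\<close>
  moreover have "30491814 / 2 ^ (2 * 13 + 1) \<le> L"
  proof (rule LIMSEQ_le_const[OF L], intro exI allI impI)
    fix n :: nat assume "2 * 13 + 1 \<le> n"
    from density_lower[OF this] show "30491814 / 2 ^ (2 * 13 + 1) \<le> density n"
      unfolding tree_leaf_lower_13 by simp
  qed
  then have "0.224863 \<le> L" by simp
  ultimately have "\<bar>L - 0.230653\<bar> \<le> 0.00579" by (intro abs_leI) simp_all
  then show ?thesis using antimono_gamma_sigma lim by blast
qed

end
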